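(* Consider the optimization problem (P2) defined in the context, with purchase prices $\alpha^t$ and selling prices $\beta^t$, $t\in\mathcal{T}=\{1,\ldots,T\}$. If (P2) is feasible and $\beta^t\le\alpha^t$ for every $t\in\mathcal{T}$, then there is no duality gap: the optimal value of (P2) equals the optimal value of the dual problem, i.e. $$\min(\text{P2}) \;=\; \sup\big\{\mathcal{D}(\mathbf{z}) : \mathbf{z}=(\{\mu^t\},\{\lambda^t\},\{\nu^t\}),\ \mu^t\ge 0,\ \lambda^t,\nu^t\in\mathbb{R},\ t\in\mathcal{T}\big\},$$ where $\mathcal{D}$ is the dual function (defined in the context) obtained by dualizing the spinning-reserve, balance, and variable-change constraints.
   Context: Index sets: $\mathcal{T}=\{1,\ldots,T\}$, $\mathcal{M}=\{1,\ldots,M\}$, $\mathcal{N}=\{1,\ldots,N\}$, $\mathcal{Q}=\{1,\ldots,Q\}$, $\mathcal{J}=\{1,\ldots,J\}$, and $I$ renewable facilities. Decision variables (all real), collected in $\mathbf{x}$: $P_{G_m}^t$, $P_{D_n}^t$, $P_{E_q}^t$, $P_{B_j}^t$, $B_j^t$, $P_R^t$, $\tilde P_R^t$ for $m\in\mathcal{M}$, $n\in\mathcal{N}$, $q\in\mathcal{Q}$, $j\in\mathcal{J}$, $t\in\mathcal{T}$. Given real constants: $P_{G_m}^{\min},P_{G_m}^{\max}$, $R_{m,\mathrm{up}},R_{m,\mathrm{down}}$, $\mathsf{SR}^t$, $L^t$, $P_{D_n}^{\min},P_{D_n}^{\max}$, $P_{E_q}^{\min,t},P_{E_q}^{\max,t}$,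 $E_q$, integers $1\le S_q\le T_q\le T$ with $P_{E_q}^{\min,t}=P_{E_q}^{\max,t}=0$ for $t\notin\{S_q,\ldots,T_q\}$, $P_{B_j}^{\min}<0<P_{B_j}^{\max}$, $B_j^{\min},B_j^{\max}$, $\eta_j\in(0,1]$, $P_R^{\min},P_R^{\max}$, prices $\alpha^t,\beta^t$, and initial values $P_{G_m}^0$, $B_j^0$. Functions: $C_m^t$ (generation cost, convex and increasing over its operating range), $U_{D_n}^t$ (utility, concave and increasing over its operating range), $U_{E_q}^t$ (utility, concave), $H_j^t$ (storage cost, convex), all real-valued on $\mathbb{R}$ and possibly non-differentiable or not strictly convex/concave. Let $\mathcal{W}\subset\mathbb{R}^{IT}$ be a nonempty polytope (bounded), with elements $\mathbf{w}=[W_1^1,\ldots,W_1^T,\ldots,W_I^1,\ldots,W_I^T]$. Put $\delta^t:=(\alpha^t-\beta^t)/2$, $\gamma^t:=(\alpha^t+\beta^t)/2$ and $$G(\{\tilde P_R^t\}):=\max_{\mathbf{w}\in\mathcal{W}}\sum_{t=1}^T\Big(\delta^t\Big|\tilde P_R^t-\sum_{i=1}^I W_i^t\Big|+\gamma^t\Big(\tilde P_R^t-\sum_{i=1}^I W_i^t\Big)\Big).$$ Problem (P2): minimize over $\mathbf{x}$ $$f(\mathbf{x})=\sum_{t=1}^T\Big(\sum_{m=1}^M C_m^t(P_{G_m}^t)-\sum_{n=1}^N U_{D_n}^t(P_{D_n}^t)-\sum_{q=1}^Q U_{E_q}^t(P_{E_q}^t)+\sum_{j=1}^J H_j^t(B_j^t)\Big)+G(\{\tilde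 P_R^t\})$$ subject to, for all $m\in\mathcal M$, $n\in\mathcal N$, $q\in\mathcal Q$, $j\in\mathcal J$, $t\in\mathcal T$: (1) $P_{G_m}^{\min}\le P_{G_m}^t\le P_{G_m}^{\max}$; (2) $P_{G_m}^t-P_{G_m}^{t-1}\le R_{m,\mathrm{up}}$; (3) $P_{G_m}^{t-1}-P_{G_m}^t\le R_{m,\mathrm{down}}$; (4) [spinning reserve] $\sum_{m=1}^M(P_{G_m}^{\max}-P_{G_m}^t)\ge\mathsf{SR}^t$; (5) $P_{D_n}^{\min}\le P_{D_n}^t\le P_{D_n}^{\max}$; (6) $P_{E_q}^{\min,t}\le P_{E_q}^t\le P_{E_q}^{\max,t}$; (7) $\sum_{t=S_q}^{T_q}P_{E_q}^t=E_q$; (8) $0\le B_j^t\le B_j^{\max}$ and $B_j^T\ge B_j^{\min}$; (9) $P_{B_j}^{\min}\le P_{B_j}^t\le P_{B_j}^{\max}$; (10) $-\eta_jB_j^{t-1}\le P_{B_j}^t$; (11) $B_j^t=B_j^{t-1}+P_{B_j}^t$; (12) $P_R^{\min}\le P_R^t\le P_R^{\max}$; (13) [balance] $\sum_{m=1}^M P_{G_m}^t+P_R^t=L^t+\sum_{n=1}^N P_{D_n}^t+\sum_{q=1}^Q P_{E_q}^t$; (14) [variable change] $\tilde P_R^t=P_R^t+\sum_{j=1}^J P_{B_j}^t$. Partial Lagrangian, with multipliers $\mu^t\ge0$ for (4), $\lambda^t\in\mathbb{R}$ for (13), $\nu^t\in\mathbb{R}$ for (14), $\mathbf z=(\{\mu^t\},\{\lambda^t\},\{\nu^t\})$: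 $$\mathcal{L}(\mathbf{x},\mathbf{z})=f(\mathbf{x})+\sum_{t=1}^T\Big\{\mu^t\Big(\mathsf{SR}^t-\sum_{m}(P_{G_m}^{\max}-P_{G_m}^t)\Big)-\lambda^t\Big(\sum_m P_{G_m}^t+P_R^t-\sum_n P_{D_n}^t-\sum_q P_{E_q}^t-L^t\Big)-\nu^t\Big(\tilde P_R^t-P_R^t-\sum_j P_{B_j}^t\Big)\Big\}.$$ Dual function: $\mathcal{D}(\mathbf z)=\inf_{\mathbf x}\mathcal{L}(\mathbf x,\mathbf z)$ over all $\mathbf{x}$ satisfying (1)–(3) and (5)–(12) (value $-\infty$ allowed).
   Formalization: The generation costs and the utilities U_D are additionally assumed continuous on their closed operating ranges (automatic if convex/concave on all of R); if convexity holds only on the range, a jump at an endpoint can create a duality gap. *)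

theory Defs
  imports "HOL-Analysis.Analysis"
begin

text \<open>
  Array-valued data and variables are functions on \<^typ>\<open>nat\<close> of which only the entries with
  indices in \<open>{1..nM}\<close>, \<open>{1..nT}\<close>, etc. are ever used.  The vectors of renewable outputs live in
  \<open>real ^ 'k\<close> with \<open>CARD('k) = nI * nT\<close>; the field \<open>coord\<close> enumerates the coordinates, so that
  \<open>w $ coord d i t\<close> is the output of facility \<open>i\<close> in slot \<open>t\<close>.
\<close>

record ('k::finite) microgrid =
  nT :: nat  nM :: nat  nN :: nat  nQ :: nat  nJ :: nat  nI :: nat
  PGmin :: "nat \<Rightarrow> real"
  PGmax :: "nat \<Rightarrow> real"
  Rup :: "nat \<Rightarrow> real"
  Rdown :: "nat \<Rightarrow> real"
  PGinit :: "nat \<Rightarrow> real"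
  reserve :: "nat \<Rightarrow> real"
  load :: "nat \<Rightarrow> real"
  PDmin :: "nat \<Rightarrow> real"
  PDmax :: "nat \<Rightarrow> real"
  PEmin :: "nat \<Rightarrow> nat \<Rightarrow> real"
  PEmax :: "nat \<Rightarrow> nat \<Rightarrow> real"
  Etotal :: "nat \<Rightarrow> real"
  Estart :: "nat \<Rightarrow> nat"
  Eend :: "nat \<Rightarrow> nat"
  PBmin :: "nat \<Rightarrow> real"
  PBmax :: "nat \<Rightarrow> real"
  Bmin :: "nat \<Rightarrow> real"
  Bmax :: "nat \<Rightarrow> real"
  Binit :: "nat \<Rightarrow> real"
  eta :: "nat \<Rightarrow> real"
  PRmin :: real
  PRmax :: real
  alpha :: "nat \<Rightarrow> real"
  beta :: "nat \<Rightarrow> real"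
  costG :: "nat \<Rightarrow> nat \<Rightarrow> real \<Rightarrow> real"
  utilD :: "nat \<Rightarrow> nat \<Rightarrow> real \<Rightarrow> real"
  utilE :: "nat \<Rightarrow> nat \<Rightarrow> real \<Rightarrow> real"
  costB :: "nat \<Rightarrow> nat \<Rightarrow> real \<Rightarrow> real"
  renewables :: "(real ^ 'k) set"
  coord :: "nat \<Rightarrow> nat \<Rightarrow> 'k"

text \<open>\<open>PRt\<close> is the auxiliary variable written with a tilde: grid exchange plus net charging.\<close>

record decision =
  PG :: "nat \<Rightarrow> nat \<Rightarrow> real"
  PD :: "nat \<Rightarrow> nat \<Rightarrow> real"
  PE :: "nat \<Rightarrow> nat \<Rightarrow> real"
  PB :: "nat \<Rightarrow> nat \<Rightarrow> real"
  SB :: "nat \<Rightarrow> nat \<Rightarrow> real"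
  PR :: "nat \<Rightarrow> real"
  PRt :: "nat \<Rightarrow> real"

text \<open>
  A convex function that is finite on the whole real line is continuous.  Since convexity of
  \<open>costG\<close> and concavity of \<open>utilD\<close> are only demanded on the closed operating range, where
  endpoint jumps would be possible (and would create a duality gap), continuity on that range
  is listed separately.
\<close>

definition admissible_data :: "('k::finite) microgrid \<Rightarrow> bool" where
  "admissible_data d \<longleftrightarrow>
    (\<forall>q\<in>{1..nQ d}. 1 \<le> Estart d q \<and> Estart d q \<le> Eend d q \<and> Eend d q \<le> nT d) \<and>
    (\<forall>q\<in>{1..nQ d}. \<forall>t\<in>{1..nT d}. t \<notin> {Estart d q..Eend d q} \<longrightarrow>
        PEmin d q t = 0 \<and> PEmax d q t = 0) \<and>
    (\<forall>j\<in>{1..nJ d}. PBmin d j < 0 \<and> 0 < PBmax d j \<and> 0 < eta d j \<and> eta d j \<le> 1) \<and>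
    (\<forall>m\<in>{1..nM d}. \<forall>t\<in>{1..nT d}.
        convex_on {PGmin d m..PGmax d m} (costG d m t) \<and>
        continuous_on {PGmin d m..PGmax d m} (costG d m t) \<and>
        mono_on {PGmin d m..PGmax d m} (costG d m t)) \<and>
    (\<forall>n\<in>{1..nN d}. \<forall>t\<in>{1..nT d}.
        concave_on {PDmin d n..PDmax d n} (utilD d n t) \<and>
        continuous_on {PDmin d n..PDmax d n} (utilD d n t) \<and>
        mono_on {PDmin d n..PDmax d n} (utilD d n t)) \<and>
    (\<forall>q\<in>{1..nQ d}. \<forall>t\<in>{1..nT d}. concave_on UNIV (utilE d q t)) \<and>
    (\<forall>j\<in>{1..nJ d}. \<forall>t\<in>{1..nT d}. convex_on UNIV (costB d j t)) \<and>
    bij_betw (\<lambda>(i, t). coord d i t) ({1..nI d} \<times> {1..nT d}) UNIV \<and>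
    polytope (renewables d) \<and> renewables d \<noteq> {}"

definition PGprev :: "('k::finite) microgrid \<Rightarrow> decision \<Rightarrow> nat \<Rightarrow> nat \<Rightarrow> real" where
  "PGprev d x m t = (if t = 1 then PGinit d m else PG x m (t - 1))"

definition SBprev :: "('k::finite) microgrid \<Rightarrow> decision \<Rightarrow> nat \<Rightarrow> nat \<Rightarrow> real" where
  "SBprev d x j t = (if t = 1 then Binit d j else SB x j (t - 1))"

definition delta :: "('k::finite) microgrid \<Rightarrow> nat \<Rightarrow> real" where
  "delta d t = (alpha d t - beta d t) / 2"

definition gamma :: "('k::finite) microgrid \<Rightarrow> nat \<Rightarrow> real" where
  "gamma d t = (alpha d t + beta d t) / 2"

definition surplus :: "('k::finite) microgrid \<Rightarrow> (nat \<Rightarrow> real) \<Rightarrow> real ^ 'k \<Rightarrow> nat \<Rightarrow> real" where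
  "surplus d p w t = p t - (\<Sum>i=1..nI d. w $ coord d i t)"

text \<open>The supremum is a maximum: a polytope is compact and the function is continuous in \<open>w\<close>.\<close>

definition worst_case_cost :: "('k::finite) microgrid \<Rightarrow> (nat \<Rightarrow> real) \<Rightarrow> real" where
  "worst_case_cost d p =
    (SUP w\<in>renewables d. \<Sum>t=1..nT d.
        delta d t * \<bar>surplus d p w t\<bar> + gamma d t * surplus d p w t)"

definition objective :: "('k::finite) microgrid \<Rightarrow> decision \<Rightarrow> real" where
  "objective d x =
    (\<Sum>t=1..nT d.
        (\<Sum>m=1..nM d. costG d m t (PG x m t))
      - (\<Sum>n=1..nN d. utilD d n t (PD x n t))
      - (\<Sum>q=1..nQ d. utilE d q t (PE x q t))
      + (\<Sum>j=1..nJ d. costB d j t (SB x j t)))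
    + worst_case_cost d (PRt x)"

definition local_constraints :: "('k::finite) microgrid \<Rightarrow> decision set" where
  "local_constraints d = {x.
    (\<forall>t\<in>{1..nT d}.
      (\<forall>m\<in>{1..nM d}.
        PGmin d m \<le> PG x m t \<and> PG x m t \<le> PGmax d m \<and>
        PG x m t - PGprev d x m t \<le> Rup d m \<and>
        PGprev d x m t - PG x m t \<le> Rdown d m) \<and>
      (\<forall>n\<in>{1..nN d}. PDmin d n \<le> PD x n t \<and> PD x n t \<le> PDmax d n) \<and>
      (\<forall>q\<in>{1..nQ d}. PEmin d q t \<le> PE x q t \<and> PE x q t \<le> PEmax d q t) \<and>
      (\<forall>j\<in>{1..nJ d}.
        0 \<le> SB x j t \<and> SB x j t \<le> Bmax d j \<and>
        PBmin d j \<le> PB x j t \<and> PB x j t \<le> PBmax d j \<and>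
        - eta d j * SBprev d x j t \<le> PB x j t \<and>
        SB x j t = SBprev d x j t + PB x j t) \<and>
      PRmin d \<le> PR x t \<and> PR x t \<le> PRmax d) \<and>
    (\<forall>q\<in>{1..nQ d}. (\<Sum>t=Estart d q..Eend d q. PE x q t) = Etotal d q) \<and>
    (\<forall>j\<in>{1..nJ d}. Bmin d j \<le> SB x j (nT d))}"

definition feasible :: "('k::finite) microgrid \<Rightarrow> decision set" where
  "feasible d = {x \<in> local_constraints d. \<forall>t\<in>{1..nT d}.
    (\<Sum>m=1..nM d. PGmax d m - PG x m t) \<ge> reserve d t \<and>
    (\<Sum>m=1..nM d. PG x m t) + PR x t =
      load d t + (\<Sum>n=1..nN d. PD x n t) + (\<Sum>q=1..nQ d. PE x q t) \<and>
    PRt x t = PR x t + (\<Sum>j=1..nJ d. PB x j t)}"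

definition Lagrangian ::
  "('k::finite) microgrid \<Rightarrow> decision \<Rightarrow> (nat \<Rightarrow> real) \<Rightarrow> (nat \<Rightarrow> real) \<Rightarrow> (nat \<Rightarrow> real) \<Rightarrow> real" where
  "Lagrangian d x mu lam nu = objective d x +
    (\<Sum>t=1..nT d.
        mu t * (reserve d t - (\<Sum>m=1..nM d. PGmax d m - PG x m t))
      - lam t * ((\<Sum>m=1..nM d. PG x m t) + PR x t
                 - (\<Sum>n=1..nN d. PD x n t) - (\<Sum>q=1..nQ d. PE x q t) - load d t)
      - nu t * (PRt x t - PR x t - (\<Sum>j=1..nJ d. PB x j t)))"

definition dual_function ::
  "('k::finite) microgrid \<Rightarrow> (nat \<Rightarrow> real) \<Rightarrow> (nat \<Rightarrow> real) \<Rightarrow> (nat \<Rightarrow> real) \<Rightarrow> ereal" where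
  "dual_function d mu lam nu = (INF x\<in>local_constraints d. ereal (Lagrangian d x mu lam nu))"

definition multipliers ::
  "('k::finite) microgrid \<Rightarrow> ((nat \<Rightarrow> real) \<times> (nat \<Rightarrow> real) \<times> (nat \<Rightarrow> real)) set" where
  "multipliers d = {(mu, lam, nu). \<forall>t\<in>{1..nT d}. 0 \<le> mu t}"

end

theory Submission
  imports Defs
begin

text \<open>
  Perturb the right-hand sides of the dualized constraints and consider the epigraph of the optimal
  value as a function of the perturbation.  It is convex because \<open>beta d t \<le> alpha d t\<close> makes the
  worst-case cost a supremum of convex functions, and closed because the local constraints are
  compact once the exchange residual is controlled.  Every point \<open>(0, q)\<close> with \<open>q\<close> below the optimal
  value can therefore be separated strictly from it; since \<open>(0, p)\<close> with \<open>p\<close> the optimal value belongs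
  to the epigraph, the hyperplane is not vertical, and its slope gives multipliers with dual value at
  least \<open>q\<close>.  No constraint qualification is needed as the dual optimum need not be attained.
\<close>

section \<open>Subsequence extraction and non-vertical separation\<close>

text \<open>Successive extraction: passing to a further subsequence for one more index keeps the
  limits already found. Decisions are records of functions on an infinite index set, so compactness
  is obtained entry by entry on the finitely many entries that matter.\<close>

lemma finite_family_convergent_subseq:
  fixes f :: "nat \<Rightarrow> 'i \<Rightarrow> real"
  assumes "finite I" and "\<And>i. i \<in> I \<Longrightarrow> bounded (range (\<lambda>n. f n i))"
  shows "\<exists>r l. strict_mono r \<and> (\<forall>i\<in>I. (\<lambda>n. f (r n) i) \<longlonglongrightarrow> l i)"
  using assms
proof (induction I rule: finite_induct)
  case empty
  show ?case by (rule exI[of _ id]) (auto simp: strict_mono_def)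
next
  case (insert j I)
  then obtain r l where r: "strict_mono r" "\<And>i. i \<in> I \<Longrightarrow> (\<lambda>n. f (r n) i) \<longlonglongrightarrow> l i"
    by (metis insertCI)
  have "bounded (range (\<lambda>n. f (r n) j))"
    by (rule bounded_subset[of "range (\<lambda>n. f n j)"]) (use insert.prems in auto)
  then obtain b s where s: "strict_mono s" "((\<lambda>n. f (r n) j) \<circ> s) \<longlonglongrightarrow> b"
    using bounded_imp_convergent_subsequence by metis
  have "(\<lambda>n. f ((r \<circ> s) n) i) \<longlonglongrightarrow> (l(j := b)) i" if "i \<in> insert j I" for i
    using that s LIMSEQ_subseq_LIMSEQ[OF r(2) s(1)] by (auto simp: o_def)
  moreover have "strict_mono (r \<circ> s)"
    using r(1) s(1) by (rule strict_mono_o)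
  ultimately show ?case by blast
qed

text \<open>Let \<open>(a, h)\<close> be the normal of a hyperplane strictly separating
  \<open>(0, q)\<close> from \<open>S\<close>. Comparing with \<open>(0, p)\<close>, which lies on
  the other side and vertically above, gives \<open>h * (p - q) > 0\<close>. Hence
  \<open>h > 0\<close>, and dividing by \<open>h\<close> turns the hyperplane into the graph of an
  affine function.\<close>

lemma supporting_functional_below_graph:
  fixes S :: "('e::euclidean_space \<times> real) set"
  assumes "convex S" "closed S" "(0, p) \<in> S" "(0, q) \<notin> S" "q < p"
  shows "\<exists>a. \<forall>u s. (u, s) \<in> S \<longrightarrow> q \<le> a \<bullet> u + s"
proof -
  obtain n b where n: "n \<bullet> (0, q) < b" "\<And>y. y \<in> S \<Longrightarrow> b < n \<bullet> y"
    using separating_hyperplane_closed_point[OF assms(1,2,4)] by blast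
  obtain a h where nah: "n = (a, h)" by (cases n)
  have lt: "h * q < a \<bullet> u + h * s" if "(u, s) \<in> S" for u s
    using n(1) n(2)[OF that] by (simp add: nah)
  have "0 < h * (p - q)"
    using lt[OF assms(3)] by (simp add: algebra_simps)
  then have h: "0 < h"
    using assms(5) by (simp add: zero_less_mult_iff)
  have "q \<le> (a /\<^sub>R h) \<bullet> u + s" if "(u, s) \<in> S" for u s
    using lt[OF that] h by (simp add: field_simps)
  then show ?thesis by blast
qed

section \<open>Convergence of decisions and closedness of the local constraints\<close>

text \<open>Only entries within the index ranges are compared; all others are irrelevant to
  constraints and costs.\<close>

definition converges_to ::
  "('k::finite) microgrid \<Rightarrow> (nat \<Rightarrow> decision) \<Rightarrow> decision \<Rightarrow> bool" where
  "converges_to d X x \<longleftrightarrow> (\<forall>t\<in>{1..nT d}.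
    (\<forall>m\<in>{1..nM d}. (\<lambda>n. PG (X n) m t) \<longlonglongrightarrow> PG x m t) \<and>
    (\<forall>m\<in>{1..nN d}. (\<lambda>n. PD (X n) m t) \<longlonglongrightarrow> PD x m t) \<and>
    (\<forall>q\<in>{1..nQ d}. (\<lambda>n. PE (X n) q t) \<longlonglongrightarrow> PE x q t) \<and>
    (\<forall>j\<in>{1..nJ d}. (\<lambda>n. PB (X n) j t) \<longlonglongrightarrow> PB x j t) \<and>
    (\<forall>j\<in>{1..nJ d}. (\<lambda>n. SB (X n) j t) \<longlonglongrightarrow> SB x j t) \<and>
    (\<lambda>n. PR (X n) t) \<longlonglongrightarrow> PR x t \<and>
    (\<lambda>n. PRt (X n) t) \<longlonglongrightarrow> PRt x t)"

text \<open>Box constraints are stated as membership in closed intervals, the form in which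
  closedness, boundedness and convexity are applied later.\<close>

lemma local_constraintsD:
  assumes "x \<in> local_constraints d" "t \<in> {1..nT d}"
  shows "m \<in> {1..nM d} \<Longrightarrow> PG x m t \<in> {PGmin d m..PGmax d m}"
    and "m \<in> {1..nM d} \<Longrightarrow> PG x m t - PGprev d x m t \<le> Rup d m"
    and "m \<in> {1..nM d} \<Longrightarrow> PGprev d x m t - PG x m t \<le> Rdown d m"
    and "n \<in> {1..nN d} \<Longrightarrow> PD x n t \<in> {PDmin d n..PDmax d n}"
    and "q \<in> {1..nQ d} \<Longrightarrow> PE x q t \<in> {PEmin d q t..PEmax d q t}"
    and "j \<in> {1..nJ d} \<Longrightarrow> SB x j t \<in> {0..Bmax d j}"
    and "j \<in> {1..nJ d} \<Longrightarrow> PB x j t \<in> {PBmin d j..PBmax d j}"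
    and "j \<in> {1..nJ d} \<Longrightarrow> - eta d j * SBprev d x j t \<le> PB x j t"
    and "j \<in> {1..nJ d} \<Longrightarrow> SB x j t = SBprev d x j t + PB x j t"
    and "PR x t \<in> {PRmin d..PRmax d}"
  using assms(1)[unfolded local_constraints_def mem_Collect_eq] assms(2)
  by (blast intro: atLeastAtMost_iff[THEN iffD2])+

lemma local_constraints_sumD:
  assumes "x \<in> local_constraints d"
  shows "q \<in> {1..nQ d} \<Longrightarrow> (\<Sum>t=Estart d q..Eend d q. PE x q t) = Etotal d q"
    and "j \<in> {1..nJ d} \<Longrightarrow> Bmin d j \<le> SB x j (nT d)"
  using assms unfolding local_constraints_def mem_Collect_eq by blast+

lemma local_constraintsI:
  assumes "\<And>t m. t \<in> {1..nT d} \<Longrightarrow> m \<in> {1..nM d} \<Longrightarrow> PG x m t \<in> {PGmin d m..PGmax d m}"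
    and "\<And>t m. t \<in> {1..nT d} \<Longrightarrow> m \<in> {1..nM d} \<Longrightarrow> PG x m t - PGprev d x m t \<le> Rup d m"
    and "\<And>t m. t \<in> {1..nT d} \<Longrightarrow> m \<in> {1..nM d} \<Longrightarrow> PGprev d x m t - PG x m t \<le> Rdown d m"
    and "\<And>t n. t \<in> {1..nT d} \<Longrightarrow> n \<in> {1..nN d} \<Longrightarrow> PD x n t \<in> {PDmin d n..PDmax d n}"
    and "\<And>t q. t \<in> {1..nT d} \<Longrightarrow> q \<in> {1..nQ d} \<Longrightarrow> PE x q t \<in> {PEmin d q t..PEmax d q t}"
    and "\<And>t j. t \<in> {1..nT d} \<Longrightarrow> j \<in> {1..nJ d} \<Longrightarrow> SB x j t \<in> {0..Bmax d j}"
    and "\<And>t j. t \<in> {1..nT d} \<Longrightarrow> j \<in> {1..nJ d} \<Longrightarrow> PB x j t \<in> {PBmin d j..PBmax d j}"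
    and "\<And>t j. t \<in> {1..nT d} \<Longrightarrow> j \<in> {1..nJ d} \<Longrightarrow> - eta d j * SBprev d x j t \<le> PB x j t"
    and "\<And>t j. t \<in> {1..nT d} \<Longrightarrow> j \<in> {1..nJ d} \<Longrightarrow> SB x j t = SBprev d x j t + PB x j t"
    and "\<And>t. t \<in> {1..nT d} \<Longrightarrow> PR x t \<in> {PRmin d..PRmax d}"
    and "\<And>q. q \<in> {1..nQ d} \<Longrightarrow> (\<Sum>t=Estart d q..Eend d q. PE x q t) = Etotal d q"
    and "\<And>j. j \<in> {1..nJ d} \<Longrightarrow> Bmin d j \<le> SB x j (nT d)"
  shows "x \<in> local_constraints d"
  unfolding local_constraints_def mem_Collect_eq
  by (intro conjI ballI; (rule assms | rule atLeastAtMost_iff[THEN iffD1, THEN conjunct1]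
      atLeastAtMost_iff[THEN iffD1, THEN conjunct2], rule assms); assumption)

text \<open>The index pairs are in bijection with the universe of a type, which is never empty, so
  neither factor of the product can be empty.\<close>

lemma admissible_nT: "admissible_data d \<Longrightarrow> 1 \<le> nT d"
  and admissible_nI: "admissible_data d \<Longrightarrow> 1 \<le> nI d"
  unfolding admissible_data_def bij_betw_def by (cases "nT d", auto)+

lemma admissible_schedule:
  assumes "admissible_data d" "q \<in> {1..nQ d}" "t \<in> {Estart d q..Eend d q}"
  shows "t \<in> {1..nT d}"
  using assms unfolding admissible_data_def by fastforce

lemma converges_to_local:
  assumes "admissible_data d" "\<And>n. X n \<in> local_constraints d" "converges_to d X x"
  shows "x \<in> local_constraints d"
proof -
  note L = local_constraintsD[OF assms(2)]
  have G: "(\<lambda>n. PG (X n) m t) \<longlonglongrightarrow> PG x m t" if "t \<in> {1..nT d}" "m \<in> {1..nM d}" for t m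
    using assms(3) that unfolding converges_to_def by blast
  \<comment> \<open>At \<open>t = 1\<close> the previous value is the fixed initial datum; in later
    slots it is an entry whose convergence is already known. The same split is used for the storage
    levels.\<close>
  have Gp: "(\<lambda>n. PGprev d (X n) m t) \<longlonglongrightarrow> PGprev d x m t"
    if "t \<in> {1..nT d}" "m \<in> {1..nM d}" for t m
    using G[of "t - 1" m] that unfolding PGprev_def by (cases "t = 1") (auto elim!: meta_mp)
  have D: "(\<lambda>n. PD (X n) m t) \<longlonglongrightarrow> PD x m t" if "t \<in> {1..nT d}" "m \<in> {1..nN d}" for t m
    using assms(3) that unfolding converges_to_def by blast
  have E: "(\<lambda>n. PE (X n) m t) \<longlonglongrightarrow> PE x m t" if "t \<in> {1..nT d}" "m \<in> {1..nQ d}" for t m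
    using assms(3) that unfolding converges_to_def by blast
  have B: "(\<lambda>n. PB (X n) m t) \<longlonglongrightarrow> PB x m t" if "t \<in> {1..nT d}" "m \<in> {1..nJ d}" for t m
    using assms(3) that unfolding converges_to_def by blast
  have S: "(\<lambda>n. SB (X n) m t) \<longlonglongrightarrow> SB x m t" if "t \<in> {1..nT d}" "m \<in> {1..nJ d}" for t m
    using assms(3) that unfolding converges_to_def by blast
  have Sp: "(\<lambda>n. SBprev d (X n) m t) \<longlonglongrightarrow> SBprev d x m t"
    if "t \<in> {1..nT d}" "m \<in> {1..nJ d}" for t m
    using S[of "t - 1" m] that unfolding SBprev_def by (cases "t = 1") (auto elim!: meta_mp)
  have R: "(\<lambda>n. PR (X n) t) \<longlonglongrightarrow> PR x t" if "t \<in> {1..nT d}" for t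
    using assms(3) that unfolding converges_to_def by blast
  note cl = closed_sequentially[OF closed_atLeastAtMost]
  show ?thesis
  proof (rule local_constraintsI)
    fix t m assume t: "t \<in> {1..nT d}" and m: "m \<in> {1..nM d}"
    show "PG x m t \<in> {PGmin d m..PGmax d m}"
      using cl[OF _ G[OF t m]] L(1)[OF t m] by blast
    show "PG x m t - PGprev d x m t \<le> Rup d m"
      by (rule LIMSEQ_le_const2[OF tendsto_diff[OF G[OF t m] Gp[OF t m]]]) (use L(2)[OF t m] in blast)
    show "PGprev d x m t - PG x m t \<le> Rdown d m"
      by (rule LIMSEQ_le_const2[OF tendsto_diff[OF Gp[OF t m] G[OF t m]]]) (use L(3)[OF t m] in blast)
  next
    fix t m assume t: "t \<in> {1..nT d}" and m: "m \<in> {1..nN d}"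
    show "PD x m t \<in> {PDmin d m..PDmax d m}"
      using cl[OF _ D[OF t m]] L(4)[OF t m] by blast
  next
    fix t m assume t: "t \<in> {1..nT d}" and m: "m \<in> {1..nQ d}"
    show "PE x m t \<in> {PEmin d m t..PEmax d m t}"
      using cl[OF _ E[OF t m]] L(5)[OF t m] by blast
  next
    fix t m assume t: "t \<in> {1..nT d}" and m: "m \<in> {1..nJ d}"
    show "SB x m t \<in> {0..Bmax d m}"
      using cl[OF _ S[OF t m]] L(6)[OF t m] by blast
    show "PB x m t \<in> {PBmin d m..PBmax d m}"
      using cl[OF _ B[OF t m]] L(7)[OF t m] by blast
    show "- eta d m * SBprev d x m t \<le> PB x m t"
      by (rule LIMSEQ_le[OF tendsto_mult_left[OF Sp[OF t m]] B[OF t m]]) (use L(8)[OF t m] in blast)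
    have "(\<lambda>n. SB (X n) m t) \<longlonglongrightarrow> SBprev d x m t + PB x m t"
      using tendsto_add[OF Sp[OF t m] B[OF t m]] L(9)[OF t m] by simp
    then show "SB x m t = SBprev d x m t + PB x m t"
      using S[OF t m] LIMSEQ_unique by blast
  next
    fix t assume t: "t \<in> {1..nT d}"
    show "PR x t \<in> {PRmin d..PRmax d}"
      using cl[OF _ R[OF t]] L(10)[OF t] by blast
  next
    fix q assume q: "q \<in> {1..nQ d}"
    have "(\<lambda>n. \<Sum>t=Estart d q..Eend d q. PE (X n) q t) \<longlonglongrightarrow> (\<Sum>t=Estart d q..Eend d q. PE x q t)"
      by (intro tendsto_sum E q admissible_schedule[OF assms(1) q])
    then show "(\<Sum>t=Estart d q..Eend d q. PE x q t) = Etotal d q"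
      using local_constraints_sumD(1)[OF assms(2) q] by (simp add: LIMSEQ_const_iff)
  next
    fix j assume j: "j \<in> {1..nJ d}"
    \<comment> \<open>The terminal level is an entry of the horizon, and hence convergent, only
      because there is at least one slot.\<close>
    have "nT d \<in> {1..nT d}"
      using admissible_nT[OF assms(1)] by simp
    from S[OF this j] show "Bmin d j \<le> SB x j (nT d)"
      by (rule LIMSEQ_le_const) (use local_constraints_sumD(2)[OF assms(2) j] in blast)
  qed
qed

section \<open>Residuals of the dualized constraints and compactness of decisions\<close>

definition exchange_residual :: "('k::finite) microgrid \<Rightarrow> decision \<Rightarrow> nat \<Rightarrow> real" where
  "exchange_residual d x t = PRt x t - PR x t - (\<Sum>j=1..nJ d. PB x j t)"

definition balance_residual :: "('k::finite) microgrid \<Rightarrow> decision \<Rightarrow> nat \<Rightarrow> real" where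
  "balance_residual d x t = (\<Sum>m=1..nM d. PG x m t) + PR x t
     - (\<Sum>n=1..nN d. PD x n t) - (\<Sum>q=1..nQ d. PE x q t) - load d t"

definition reserve_residual :: "('k::finite) microgrid \<Rightarrow> decision \<Rightarrow> nat \<Rightarrow> real" where
  "reserve_residual d x t = reserve d t - (\<Sum>m=1..nM d. PGmax d m - PG x m t)"

lemma feasible_iff:
  "x \<in> feasible d \<longleftrightarrow> x \<in> local_constraints d \<and> (\<forall>t\<in>{1..nT d}.
     reserve_residual d x t \<le> 0 \<and> balance_residual d x t = 0 \<and> exchange_residual d x t = 0)"
  unfolding feasible_def reserve_residual_def balance_residual_def exchange_residual_def
  by (auto simp: algebra_simps)

lemma Lagrangian_residuals:
  "Lagrangian d x mu lam nu = objective d x + (\<Sum>t=1..nT d. mu t * reserve_residual d x t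
     - lam t * balance_residual d x t - nu t * exchange_residual d x t)"
  unfolding Lagrangian_def reserve_residual_def balance_residual_def exchange_residual_def
  by simp

lemma converges_to_residuals:
  assumes "converges_to d X x" "t \<in> {1..nT d}"
  shows "(\<lambda>n. reserve_residual d (X n) t) \<longlonglongrightarrow> reserve_residual d x t"
    and "(\<lambda>n. balance_residual d (X n) t) \<longlonglongrightarrow> balance_residual d x t"
    and "(\<lambda>n. exchange_residual d (X n) t) \<longlonglongrightarrow> exchange_residual d x t"
  unfolding reserve_residual_def balance_residual_def exchange_residual_def
  using assms unfolding converges_to_def by (auto intro!: tendsto_intros)

text \<open>The variable \<open>PRt\<close> is unbounded on \<open>local_constraints d\<close>; control of the exchange residual
  restores compactness.\<close>

lemma local_convergent_subseq:
  assumes "admissible_data d" "\<And>n. X n \<in> local_constraints d"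
    and "\<And>t. t \<in> {1..nT d} \<Longrightarrow> (\<lambda>n. exchange_residual d (X n) t) \<longlonglongrightarrow> c t"
  shows "\<exists>r x. strict_mono r \<and> x \<in> local_constraints d \<and> converges_to d (X \<circ> r) x"
proof -
  \<comment> \<open>The six blocks bounded by the local constraints are packed into one finite
    family indexed by block, entry and slot. \<open>PR\<close> has no entry index and gets the dummy
    index 0; \<open>PRt\<close> is left out because no local constraint bounds it.\<close>
  define f where "f n = (\<lambda>(k::nat, i, t).
    [PG (X n) i t, PD (X n) i t, PE (X n) i t, PB (X n) i t, SB (X n) i t, PR (X n) t] ! k)" for n
  define I where "I = {0::nat} \<times> {1..nM d} \<times> {1..nT d} \<union> {1} \<times> {1..nN d} \<times> {1..nT d}
    \<union> {2} \<times> {1..nQ d} \<times> {1..nT d} \<union> {3} \<times> {1..nJ d} \<times> {1..nT d}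
    \<union> {4} \<times> {1..nJ d} \<times> {1..nT d} \<union> {5} \<times> {0} \<times> {1..nT d}"
  have "bounded (range (\<lambda>n. f n i))" if "i \<in> I" for i
  proof -
    obtain k l t where i: "i = (k, l, t)" by (cases i)
    with that have t: "t \<in> {1..nT d}" unfolding I_def by auto
    note L = local_constraintsD[OF assms(2) t]
    have "\<exists>a b. \<forall>n. f n i \<in> {a..b}"
      using that L(1)[of l] L(4)[of l] L(5)[of l] L(6)[of l] L(7)[of l] L(10)
      unfolding i f_def I_def by (auto simp del: atLeastAtMost_iff) blast+
    then obtain a b where "\<And>n. f n i \<in> {a..b}" by blast
    then show ?thesis
      by (intro bounded_subset[OF bounded_closed_interval]) blast
  qed
  moreover have "finite I" unfolding I_def by simp
  ultimately obtain r l where r: "strict_mono r" "\<And>i. i \<in> I \<Longrightarrow> (\<lambda>n. f (r n) i) \<longlonglongrightarrow> l i"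
    using finite_family_convergent_subseq[of I f] by blast
  \<comment> \<open>The missing \<open>PRt\<close> is solved for from the limit \<open>c t\<close>
    of the exchange residual.\<close>
  define x where "x = \<lparr>PG = \<lambda>m t. l (0, m, t), PD = \<lambda>m t. l (1, m, t), PE = \<lambda>m t. l (2, m, t),
    PB = \<lambda>m t. l (3, m, t), SB = \<lambda>m t. l (4, m, t), PR = \<lambda>t. l (5, 0, t),
    PRt = \<lambda>t. c t + l (5, 0, t) + (\<Sum>j=1..nJ d. l (3, j, t))\<rparr>"
  have G: "(\<lambda>n. PG (X (r n)) m t) \<longlonglongrightarrow> PG x m t" if "t \<in> {1..nT d}" "m \<in> {1..nM d}" for m t
    using r(2)[of "(0, m, t)"] that unfolding f_def I_def x_def by simp
  have D: "(\<lambda>n. PD (X (r n)) m t) \<longlonglongrightarrow> PD x m t" if "t \<in> {1..nT d}" "m \<in> {1..nN d}" for m t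
    using r(2)[of "(1, m, t)"] that unfolding f_def I_def x_def by simp
  have E: "(\<lambda>n. PE (X (r n)) m t) \<longlonglongrightarrow> PE x m t" if "t \<in> {1..nT d}" "m \<in> {1..nQ d}" for m t
    using r(2)[of "(2, m, t)"] that unfolding f_def I_def x_def by simp
  have B: "(\<lambda>n. PB (X (r n)) m t) \<longlonglongrightarrow> PB x m t" if "t \<in> {1..nT d}" "m \<in> {1..nJ d}" for m t
    using r(2)[of "(3, m, t)"] that unfolding f_def I_def x_def by simp
  have S: "(\<lambda>n. SB (X (r n)) m t) \<longlonglongrightarrow> SB x m t" if "t \<in> {1..nT d}" "m \<in> {1..nJ d}" for m t
    using r(2)[of "(4, m, t)"] that unfolding f_def I_def x_def by simp
  have R: "(\<lambda>n. PR (X (r n)) t) \<longlonglongrightarrow> PR x t" if "t \<in> {1..nT d}" for t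
    using r(2)[of "(5, 0, t)"] that unfolding f_def I_def x_def by simp
  have Rt: "(\<lambda>n. PRt (X (r n)) t) \<longlonglongrightarrow> PRt x t" if t: "t \<in> {1..nT d}" for t
  proof -
    have "(\<lambda>n. exchange_residual d (X (r n)) t + PR (X (r n)) t + (\<Sum>j=1..nJ d. PB (X (r n)) j t))
      \<longlonglongrightarrow> c t + PR x t + (\<Sum>j=1..nJ d. PB x j t)"
      using LIMSEQ_subseq_LIMSEQ[OF assms(3)[OF t] r(1)]
      by (intro tendsto_add R[OF t] tendsto_sum B[OF t]) (simp_all add: o_def)
    then show ?thesis by (simp add: exchange_residual_def x_def)
  qed
  have conv: "converges_to d (X \<circ> r) x"
    unfolding converges_to_def using G D E B S R Rt by simp
  then have "x \<in> local_constraints d"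
    using converges_to_local[OF assms(1) _ conv] assms(2) by simp
  with r(1) conv show ?thesis by blast
qed

section \<open>The objective as a supremum over scenarios, and continuity of its parts\<close>

definition scenario_cost ::
  "('k::finite) microgrid \<Rightarrow> (nat \<Rightarrow> real) \<Rightarrow> real ^ 'k \<Rightarrow> real" where
  "scenario_cost d p w =
    (\<Sum>t=1..nT d. delta d t * \<bar>surplus d p w t\<bar> + gamma d t * surplus d p w t)"

definition private_cost :: "('k::finite) microgrid \<Rightarrow> decision \<Rightarrow> real" where
  "private_cost d x =
    (\<Sum>t=1..nT d.
        (\<Sum>m=1..nM d. costG d m t (PG x m t))
      - (\<Sum>n=1..nN d. utilD d n t (PD x n t))
      - (\<Sum>q=1..nQ d. utilE d q t (PE x q t))
      + (\<Sum>j=1..nJ d. costB d j t (SB x j t)))"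

text \<open>A continuous function on a compact polytope is bounded. This makes the real-valued
  supremum in \<open>worst_case_cost\<close> a genuine least upper bound.\<close>

lemma scenario_cost_bdd_above:
  assumes "admissible_data d"
  shows "bdd_above (scenario_cost d p ` renewables d)"
proof -
  have "compact (renewables d)"
    using assms unfolding admissible_data_def by (blast intro: polytope_imp_compact)
  moreover have "continuous_on (renewables d) (scenario_cost d p)"
    unfolding scenario_cost_def surplus_def by (intro continuous_intros)
  ultimately show ?thesis
    by (intro bounded_imp_bdd_above compact_imp_bounded compact_continuous_image)
qed

text \<open>A supremum lies below a level exactly when each of its members does. Convexity and limit
  arguments can thus be carried out for a fixed scenario \<open>w\<close>, without studying the
  worst-case cost as a function.\<close>

lemma objective_le_iff:
  assumes "admissible_data d"
  shows "objective d x \<le> s \<longleftrightarrow>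
    (\<forall>w\<in>renewables d. private_cost d x + scenario_cost d (PRt x) w \<le> s)"
proof -
  have "renewables d \<noteq> {}"
    using assms unfolding admissible_data_def by blast
  then have "worst_case_cost d (PRt x) \<le> s - private_cost d x \<longleftrightarrow>
      (\<forall>w\<in>renewables d. scenario_cost d (PRt x) w \<le> s - private_cost d x)"
    unfolding worst_case_cost_def scenario_cost_def[symmetric]
    using scenario_cost_bdd_above[OF assms] by (rule cSUP_le_iff)
  then show ?thesis
    unfolding objective_def private_cost_def[symmetric] by (simp add: algebra_simps)
qed

text \<open>Generation costs and demand utilities are continuous only on their operating ranges, so
  the sequence and its limit must both stay there; the limit does because the local constraints are
  closed. The other two families are convex or concave on the whole line and therefore
  continuous.\<close>

lemma converges_to_private_cost:
  assumes adm: "admissible_data d" and loc: "\<And>n. X n \<in> local_constraints d"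
    and conv: "converges_to d X x"
  shows "(\<lambda>n. private_cost d (X n)) \<longlonglongrightarrow> private_cost d x"
proof -
  note L = local_constraintsD[OF loc]
    and Lx = local_constraintsD[OF converges_to_local[OF adm loc conv]]
  note c = conv[unfolded converges_to_def, rule_format]
  have G: "(\<lambda>n. costG d m t (PG (X n) m t)) \<longlonglongrightarrow> costG d m t (PG x m t)"
    if "t \<in> {1..nT d}" "m \<in> {1..nM d}" for t m
  proof (rule continuous_on_tendsto_compose[where f = "costG d m t"])
    show "continuous_on {PGmin d m..PGmax d m} (costG d m t)"
      using adm that unfolding admissible_data_def by blast
  qed (use that c[OF that(1)] L(1)[OF that] Lx(1)[OF that] in \<open>auto simp del: atLeastAtMost_iff\<close>)
  have D: "(\<lambda>n. utilD d m t (PD (X n) m t)) \<longlonglongrightarrow> utilD d m t (PD x m t)"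
    if "t \<in> {1..nT d}" "m \<in> {1..nN d}" for t m
  proof (rule continuous_on_tendsto_compose[where f = "utilD d m t"])
    show "continuous_on {PDmin d m..PDmax d m} (utilD d m t)"
      using adm that unfolding admissible_data_def by blast
  qed (use that c[OF that(1)] L(4)[OF that] Lx(4)[OF that] in \<open>auto simp del: atLeastAtMost_iff\<close>)
  have E: "(\<lambda>n. utilE d m t (PE (X n) m t)) \<longlonglongrightarrow> utilE d m t (PE x m t)"
    if "t \<in> {1..nT d}" "m \<in> {1..nQ d}" for t m
  proof (rule continuous_on_tendsto_compose[where f = "utilE d m t"])
    have "convex_on UNIV (\<lambda>y. - utilE d m t y)"
      using adm that unfolding admissible_data_def concave_on_def by blast
    from continuous_on_minus[OF convex_on_continuous[OF open_UNIV this]]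
    show "continuous_on UNIV (utilE d m t)" by simp
  qed (use that c[OF that(1)] in auto)
  have B: "(\<lambda>n. costB d m t (SB (X n) m t)) \<longlonglongrightarrow> costB d m t (SB x m t)"
    if "t \<in> {1..nT d}" "m \<in> {1..nJ d}" for t m
  proof (rule continuous_on_tendsto_compose[where f = "costB d m t"])
    have "convex_on UNIV (costB d m t)"
      using adm that unfolding admissible_data_def by blast
    then show "continuous_on UNIV (costB d m t)"
      by (rule convex_on_continuous[OF open_UNIV])
  qed (use that c[OF that(1)] in auto)
  show ?thesis
    unfolding private_cost_def by (intro tendsto_intros G D E B)
qed

lemma converges_to_scenario_cost:
  assumes "converges_to d X x"
  shows "(\<lambda>n. scenario_cost d (PRt (X n)) w) \<longlonglongrightarrow> scenario_cost d (PRt x) w"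
  unfolding scenario_cost_def surplus_def
  using assms[unfolded converges_to_def] by (intro tendsto_intros) blast+

section \<open>Convex combinations of decisions\<close>

text \<open>The record type carries no vector space structure, so the combination is built field by
  field. Two separate weights match the usual form of convexity.\<close>

definition mix :: "real \<Rightarrow> decision \<Rightarrow> real \<Rightarrow> decision \<Rightarrow> decision" where
  "mix u x v y = \<lparr>
     PG = \<lambda>i t. u * PG x i t + v * PG y i t,
     PD = \<lambda>i t. u * PD x i t + v * PD y i t,
     PE = \<lambda>i t. u * PE x i t + v * PE y i t,
     PB = \<lambda>i t. u * PB x i t + v * PB y i t,
     SB = \<lambda>i t. u * SB x i t + v * SB y i t,
     PR = \<lambda>t. u * PR x t + v * PR y t,
     PRt = \<lambda>t. u * PRt x t + v * PRt y t\<rparr>"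

lemma mix_sel:
  "PG (mix u x v y) i t = u * PG x i t + v * PG y i t"
  "PD (mix u x v y) i t = u * PD x i t + v * PD y i t"
  "PE (mix u x v y) i t = u * PE x i t + v * PE y i t"
  "PB (mix u x v y) i t = u * PB x i t + v * PB y i t"
  "SB (mix u x v y) i t = u * SB x i t + v * SB y i t"
  "PR (mix u x v y) t = u * PR x t + v * PR y t"
  "PRt (mix u x v y) t = u * PRt x t + v * PRt y t"
  by (simp_all add: mix_def)

context
  fixes u v :: real
  assumes uv: "0 \<le> u" "0 \<le> v" "u + v = 1"
begin

text \<open>Constant data (initial values, ramp limits, loads) are rewritten as combinations of
  themselves, so that affine relations can be mixed like linear ones.\<close>

lemma affine_const: "c = u * c + v * (c::real)"
  using uv(3) by (metis mult.left_neutral distrib_right)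

lemma mix_prev:
  "PGprev d (mix u x v y) i t = u * PGprev d x i t + v * PGprev d y i t"
  "SBprev d (mix u x v y) i t = u * SBprev d x i t + v * SBprev d y i t"
  unfolding PGprev_def SBprev_def mix_sel by (simp_all add: affine_const[symmetric])

lemma mix_interval:
  "a \<in> {l..h} \<Longrightarrow> b \<in> {l..h} \<Longrightarrow> u * a + v * b \<in> {l..(h::real)}"
  using convexD[OF convex_real_interval(5), of a l h b u v] uv by simp

lemma mix_mono: "a \<le> a' \<Longrightarrow> b \<le> b' \<Longrightarrow> u * a + v * b \<le> u * a' + v * (b'::real)"
  using uv by (intro add_mono mult_left_mono)

text \<open>Every local constraint is an affine equation or inequality in the decision, the initial
  values supplying part of the constants.\<close>

lemma mix_local:
  assumes adm: "admissible_data d" and x: "x \<in> local_constraints d" and y: "y \<in> local_constraints d"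
  shows "mix u x v y \<in> local_constraints d"
proof -
  note X = local_constraintsD[OF x] and Y = local_constraintsD[OF y]
  note SX = local_constraints_sumD[OF x] and SY = local_constraints_sumD[OF y]
  show ?thesis
  proof (rule local_constraintsI, unfold mix_sel mix_prev)
    fix t m assume t: "t \<in> {1..nT d}" and m: "m \<in> {1..nM d}"
    show "u * PG x m t + v * PG y m t - (u * PGprev d x m t + v * PGprev d y m t) \<le> Rup d m"
      using mix_mono[OF X(2)[OF t m] Y(2)[OF t m]] affine_const[of "Rup d m"]
      by (simp add: algebra_simps)
    show "u * PGprev d x m t + v * PGprev d y m t - (u * PG x m t + v * PG y m t) \<le> Rdown d m"
      using mix_mono[OF X(3)[OF t m] Y(3)[OF t m]] affine_const[of "Rdown d m"]
      by (simp add: algebra_simps)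
  next
    fix t j assume t: "t \<in> {1..nT d}" and j: "j \<in> {1..nJ d}"
    show "- eta d j * (u * SBprev d x j t + v * SBprev d y j t) \<le> u * PB x j t + v * PB y j t"
      using mix_mono[OF X(8)[OF t j] Y(8)[OF t j]] by (simp add: algebra_simps)
    show "u * SB x j t + v * SB y j t =
        u * SBprev d x j t + v * SBprev d y j t + (u * PB x j t + v * PB y j t)"
      unfolding X(9)[OF t j] Y(9)[OF t j] by (simp add: algebra_simps)
  next
    fix q assume q: "q \<in> {1..nQ d}"
    show "(\<Sum>t=Estart d q..Eend d q. u * PE x q t + v * PE y q t) = Etotal d q"
      using SX(1)[OF q] SY(1)[OF q]
      by (simp add: sum.distrib sum_distrib_left[symmetric] affine_const[symmetric])
  next
    fix j assume j: "j \<in> {1..nJ d}"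
    show "Bmin d j \<le> u * SB x j (nT d) + v * SB y j (nT d)"
      using mix_mono[OF SX(2)[OF j] SY(2)[OF j]] affine_const[of "Bmin d j"] by simp
  qed (intro mix_interval X Y; assumption)+
qed

lemma mix_residuals:
  "reserve_residual d (mix u x v y) t = u * reserve_residual d x t + v * reserve_residual d y t"
  "balance_residual d (mix u x v y) t = u * balance_residual d x t + v * balance_residual d y t"
  "exchange_residual d (mix u x v y) t = u * exchange_residual d x t + v * exchange_residual d y t"
proof -
  \<comment> \<open>The constant part is isolated from the sum so that \<open>affine_const\<close>
    can be applied to it as a whole.\<close>
  have r: "reserve_residual d z t = (reserve d t - (\<Sum>m=1..nM d. PGmax d m)) + (\<Sum>m=1..nM d. PG z m t)"
    for z
    unfolding reserve_residual_def by (simp add: sum_subtractf)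
  show "reserve_residual d (mix u x v y) t = u * reserve_residual d x t + v * reserve_residual d y t"
    unfolding r mix_sel
    using affine_const[of "reserve d t - (\<Sum>m=1..nM d. PGmax d m)"]
    by (simp add: sum.distrib sum_distrib_left[symmetric] algebra_simps)
  show "balance_residual d (mix u x v y) t = u * balance_residual d x t + v * balance_residual d y t"
    unfolding balance_residual_def mix_sel
    using affine_const[of "load d t"]
    by (simp add: sum.distrib sum_distrib_left[symmetric] algebra_simps)
  show "exchange_residual d (mix u x v y) t
      = u * exchange_residual d x t + v * exchange_residual d y t"
    unfolding exchange_residual_def mix_sel
    by (simp add: sum.distrib sum_distrib_left[symmetric] algebra_simps)
qed

lemma mix_private_cost:
  assumes adm: "admissible_data d" and x: "x \<in> local_constraints d" and y: "y \<in> local_constraints d"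
  shows "private_cost d (mix u x v y) \<le> u * private_cost d x + v * private_cost d y"
proof -
  note X = local_constraintsD[OF x] and Y = local_constraintsD[OF y]
  have cvx: "f (u * a + v * b) \<le> u * f a + v * f b"
    if "convex_on A f" "a \<in> A" "b \<in> A" for f :: "real \<Rightarrow> real" and A a b
    using that uv unfolding convex_on_def by simp
  have G: "costG d m t (u * PG x m t + v * PG y m t)
      \<le> u * costG d m t (PG x m t) + v * costG d m t (PG y m t)"
    if "t \<in> {1..nT d}" "m \<in> {1..nM d}" for t m
    by (rule cvx[of "{PGmin d m..PGmax d m}"])
      (use adm that X(1)[OF that] Y(1)[OF that] in
        \<open>auto simp: admissible_data_def simp del: atLeastAtMost_iff\<close>)
  have D: "- utilD d m t (u * PD x m t + v * PD y m t)
      \<le> u * - utilD d m t (PD x m t) + v * - utilD d m t (PD y m t)"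
    if "t \<in> {1..nT d}" "m \<in> {1..nN d}" for t m
    by (rule cvx[of "{PDmin d m..PDmax d m}" "\<lambda>z. - utilD d m t z"])
      (use adm that X(4)[OF that] Y(4)[OF that] in
        \<open>auto simp: admissible_data_def concave_on_def simp del: atLeastAtMost_iff\<close>)
  have E: "- utilE d m t (u * PE x m t + v * PE y m t)
      \<le> u * - utilE d m t (PE x m t) + v * - utilE d m t (PE y m t)"
    if "t \<in> {1..nT d}" "m \<in> {1..nQ d}" for t m
    by (rule cvx[of UNIV "\<lambda>z. - utilE d m t z"])
      (use adm that in \<open>auto simp: admissible_data_def concave_on_def\<close>)
  have B: "costB d m t (u * SB x m t + v * SB y m t)
      \<le> u * costB d m t (SB x m t) + v * costB d m t (SB y m t)"
    if "t \<in> {1..nT d}" "m \<in> {1..nJ d}" for t m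
    by (rule cvx[of UNIV]) (use adm that in \<open>auto simp: admissible_data_def\<close>)
  \<comment> \<open>Moving the minus signs inside the sums leaves a sum of convex terms, which can
    be compared termwise.\<close>
  have alt: "private_cost d z = (\<Sum>t=1..nT d.
        (\<Sum>m=1..nM d. costG d m t (PG z m t)) + (\<Sum>n=1..nN d. - utilD d n t (PD z n t))
      + (\<Sum>q=1..nQ d. - utilE d q t (PE z q t)) + (\<Sum>j=1..nJ d. costB d j t (SB z j t)))" for z
    unfolding private_cost_def by (simp add: sum_negf)
  have "private_cost d (mix u x v y) \<le> (\<Sum>t=1..nT d.
        (\<Sum>m=1..nM d. u * costG d m t (PG x m t) + v * costG d m t (PG y m t))
      + (\<Sum>n=1..nN d. u * - utilD d n t (PD x n t) + v * - utilD d n t (PD y n t))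
      + (\<Sum>q=1..nQ d. u * - utilE d q t (PE x q t) + v * - utilE d q t (PE y q t))
      + (\<Sum>j=1..nJ d. u * costB d j t (SB x j t) + v * costB d j t (SB y j t)))"
    unfolding alt mix_sel by (intro sum_mono add_mono G D E B)
  also have "\<dots> = u * private_cost d x + v * private_cost d y"
    unfolding alt sum_distrib_left sum.distrib distrib_left by simp
  finally show ?thesis .
qed

text \<open>The only use of the price condition: it makes the weight of the absolute value nonnegative.\<close>

lemma mix_scenario_cost:
  assumes "\<forall>t\<in>{1..nT d}. beta d t \<le> alpha d t"
  shows "scenario_cost d (PRt (mix u x v y)) w
    \<le> u * scenario_cost d (PRt x) w + v * scenario_cost d (PRt y) w"
proof -
  have s: "surplus d (PRt (mix u x v y)) w t
      = u * surplus d (PRt x) w t + v * surplus d (PRt y) w t" for t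
    unfolding surplus_def mix_sel using affine_const[of "\<Sum>i=1..nI d. w $ coord d i t"]
    by (simp add: algebra_simps)
  have "delta d t * \<bar>u * a + v * b\<bar> + gamma d t * (u * a + v * b)
      \<le> u * (delta d t * \<bar>a\<bar> + gamma d t * a) + v * (delta d t * \<bar>b\<bar> + gamma d t * b)"
    if "t \<in> {1..nT d}" for t a b
  proof -
    have "\<bar>u * a + v * b\<bar> \<le> u * \<bar>a\<bar> + v * \<bar>b\<bar>"
      using abs_triangle_ineq[of "u * a" "v * b"] uv by (simp add: abs_mult)
    moreover have "0 \<le> delta d t"
      using assms that unfolding delta_def by simp
    ultimately have "delta d t * \<bar>u * a + v * b\<bar> \<le> delta d t * (u * \<bar>a\<bar> + v * \<bar>b\<bar>)"
      by (rule mult_left_mono)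
    then show ?thesis by (simp add: algebra_simps)
  qed
  then show ?thesis
    unfolding scenario_cost_def s sum_distrib_left sum.distrib[symmetric] by (intro sum_mono)
qed

text \<open>For each scenario both cost parts are convex, and a bound valid in every scenario passes
  to the supremum. Upper bounds \<open>a\<close> and \<open>b\<close> take the place of the
  objective values to fit the epigraph.\<close>

lemma mix_objective:
  assumes adm: "admissible_data d" and price: "\<forall>t\<in>{1..nT d}. beta d t \<le> alpha d t"
    and x: "x \<in> local_constraints d" "objective d x \<le> a"
    and y: "y \<in> local_constraints d" "objective d y \<le> b"
  shows "objective d (mix u x v y) \<le> u * a + v * b"
  unfolding objective_le_iff[OF adm]
proof
  fix w assume w: "w \<in> renewables d"
  have xa: "private_cost d x + scenario_cost d (PRt x) w \<le> a"
    using x(2) w unfolding objective_le_iff[OF adm] by blast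
  have yb: "private_cost d y + scenario_cost d (PRt y) w \<le> b"
    using y(2) w unfolding objective_le_iff[OF adm] by blast
  show "private_cost d (mix u x v y) + scenario_cost d (PRt (mix u x v y)) w \<le> u * a + v * b"
    using mix_mono[OF xa yb] mix_private_cost[OF adm x(1) y(1)] mix_scenario_cost[OF price, of x y w]
    by (simp add: algebra_simps)
qed

end

section \<open>The epigraph of the perturbed optimal value\<close>

text \<open>The residuals of one slot are stored at the coordinate of facility 1, so the index type \<open>'k\<close> of
  the renewable outputs also serves as an index type for the slots; the remaining coordinates are
  unconstrained.\<close>

definition perturbation_epigraph ::
  "('k::finite) microgrid \<Rightarrow> (((real ^ 'k) \<times> (real ^ 'k) \<times> (real ^ 'k)) \<times> real) set" where
  "perturbation_epigraph d = {((a, b, c), s). \<exists>x\<in>local_constraints d. objective d x \<le> s \<and>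
    (\<forall>t\<in>{1..nT d}. reserve_residual d x t \<le> a $ coord d 1 t \<and>
      balance_residual d x t = b $ coord d 1 t \<and> exchange_residual d x t = c $ coord d 1 t)}"

lemma perturbation_epigraph_iff:
  "((a, b, c), s) \<in> perturbation_epigraph d \<longleftrightarrow> (\<exists>x\<in>local_constraints d. objective d x \<le> s \<and>
    (\<forall>t\<in>{1..nT d}. reserve_residual d x t \<le> a $ coord d 1 t \<and>
      balance_residual d x t = b $ coord d 1 t \<and> exchange_residual d x t = c $ coord d 1 t))"
  unfolding perturbation_epigraph_def by simp

text \<open>The fibre over the zero perturbation leads back to the original problem, both for
  attainment and for separation.\<close>

lemma perturbation_epigraph_zero:
  "(0, s) \<in> perturbation_epigraph d \<longleftrightarrow> (\<exists>x\<in>feasible d. objective d x \<le> s)"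
  unfolding zero_prod_def perturbation_epigraph_iff by (auto simp: feasible_iff Bex_def)

text \<open>Witnesses are mixed with the same weights as the points: residuals mix exactly,
  objective bounds by convexity.\<close>

lemma convex_perturbation_epigraph:
  assumes "admissible_data d" "\<forall>t\<in>{1..nT d}. beta d t \<le> alpha d t"
  shows "convex (perturbation_epigraph d)"
proof (rule convexI)
  fix p q :: "((real ^ 'a) \<times> (real ^ 'a) \<times> (real ^ 'a)) \<times> real" and u v :: real
  assume p: "p \<in> perturbation_epigraph d" and q: "q \<in> perturbation_epigraph d"
    and uv: "0 \<le> u" "0 \<le> v" "u + v = 1"
  obtain a b c s where pe: "p = ((a, b, c), s)" by (metis prod.exhaust)
  obtain a' b' c' s' where qe: "q = ((a', b', c'), s')" by (metis prod.exhaust)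
  obtain x where x: "x \<in> local_constraints d" "objective d x \<le> s"
    and xr: "\<And>t. t \<in> {1..nT d} \<Longrightarrow> reserve_residual d x t \<le> a $ coord d 1 t"
      "\<And>t. t \<in> {1..nT d} \<Longrightarrow> balance_residual d x t = b $ coord d 1 t"
      "\<And>t. t \<in> {1..nT d} \<Longrightarrow> exchange_residual d x t = c $ coord d 1 t"
    using p unfolding pe perturbation_epigraph_iff by blast
  obtain y where y: "y \<in> local_constraints d" "objective d y \<le> s'"
    and yr: "\<And>t. t \<in> {1..nT d} \<Longrightarrow> reserve_residual d y t \<le> a' $ coord d 1 t"
      "\<And>t. t \<in> {1..nT d} \<Longrightarrow> balance_residual d y t = b' $ coord d 1 t"
      "\<And>t. t \<in> {1..nT d} \<Longrightarrow> exchange_residual d y t = c' $ coord d 1 t"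
    using q unfolding qe perturbation_epigraph_iff by blast
  show "u *\<^sub>R p + v *\<^sub>R q \<in> perturbation_epigraph d"
    unfolding pe qe scaleR_Pair add_Pair perturbation_epigraph_iff
  proof (intro bexI[of _ "mix u x v y"] conjI ballI)
    show "objective d (mix u x v y) \<le> u *\<^sub>R s + v *\<^sub>R s'"
      using mix_objective[OF uv assms x y] by simp
    show "mix u x v y \<in> local_constraints d"
      by (rule mix_local[OF uv assms(1) x(1) y(1)])
    fix t assume t: "t \<in> {1..nT d}"
    show "reserve_residual d (mix u x v y) t \<le> (u *\<^sub>R a + v *\<^sub>R a') $ coord d 1 t"
      using mix_mono[OF uv xr(1)[OF t] yr(1)[OF t]] by (simp add: mix_residuals[OF uv])
    show "balance_residual d (mix u x v y) t = (u *\<^sub>R b + v *\<^sub>R b') $ coord d 1 t"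
      using xr(2)[OF t] yr(2)[OF t] by (simp add: mix_residuals[OF uv])
    show "exchange_residual d (mix u x v y) t = (u *\<^sub>R c + v *\<^sub>R c') $ coord d 1 t"
      using xr(3)[OF t] yr(3)[OF t] by (simp add: mix_residuals[OF uv])
  qed
qed

text \<open>Choose a witness for each point of a convergent sequence. A subsequence of the witnesses
  converges, and its limit is a witness for the limit point.\<close>

lemma closed_perturbation_epigraph:
  assumes adm: "admissible_data d"
  shows "closed (perturbation_epigraph d)"
  unfolding closed_sequential_limits
proof (intro allI impI, elim conjE)
  fix Y and p :: "((real ^ 'a) \<times> (real ^ 'a) \<times> (real ^ 'a)) \<times> real"
  assume Y: "\<forall>n. Y n \<in> perturbation_epigraph d" and lim: "Y \<longlonglongrightarrow> p"
  define A where "A n = fst (fst (Y n))" for n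
  define B where "B n = fst (snd (fst (Y n)))" for n
  define C where "C n = snd (snd (fst (Y n)))" for n
  define S where "S n = snd (Y n)" for n
  obtain a b c s where pe: "p = ((a, b, c), s)" by (metis prod.exhaust)
  have lims: "A \<longlonglongrightarrow> a" "B \<longlonglongrightarrow> b" "C \<longlonglongrightarrow> c" "S \<longlonglongrightarrow> s"
    using tendsto_fst[OF tendsto_fst[OF lim]] tendsto_fst[OF tendsto_snd[OF tendsto_fst[OF lim]]]
      tendsto_snd[OF tendsto_snd[OF tendsto_fst[OF lim]]] tendsto_snd[OF lim]
    unfolding pe A_def B_def C_def S_def by simp_all
  have "((A n, B n, C n), S n) \<in> perturbation_epigraph d" for n
    using Y unfolding A_def B_def C_def S_def by simp
  then have "\<exists>x\<in>local_constraints d. objective d x \<le> S n \<and>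
    (\<forall>t\<in>{1..nT d}. reserve_residual d x t \<le> A n $ coord d 1 t \<and>
      balance_residual d x t = B n $ coord d 1 t \<and> exchange_residual d x t = C n $ coord d 1 t)" for n
    unfolding perturbation_epigraph_iff .
  then obtain X where X: "\<And>n. X n \<in> local_constraints d" "\<And>n. objective d (X n) \<le> S n"
    and Xr: "\<And>n t. t \<in> {1..nT d} \<Longrightarrow> reserve_residual d (X n) t \<le> A n $ coord d 1 t"
      "\<And>n t. t \<in> {1..nT d} \<Longrightarrow> balance_residual d (X n) t = B n $ coord d 1 t"
      "\<And>n t. t \<in> {1..nT d} \<Longrightarrow> exchange_residual d (X n) t = C n $ coord d 1 t"
    by metis
  \<comment> \<open>The third perturbation component converges, which is the control of
    \<open>PRt\<close> needed for extracting a subsequence.\<close>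
  have "(\<lambda>n. exchange_residual d (X n) t) \<longlonglongrightarrow> c $ coord d 1 t" if "t \<in> {1..nT d}" for t
    using tendsto_vec_nth[OF lims(3)] Xr(3)[OF that] by simp
  from local_convergent_subseq[OF adm X(1) this]
  obtain r x where r: "strict_mono r" and x: "x \<in> local_constraints d"
    and conv: "converges_to d (X \<circ> r) x" by blast
  note sub = LIMSEQ_subseq_LIMSEQ[OF _ r, unfolded o_def]
  note lims' = lims[THEN sub]
  note res = converges_to_residuals[OF conv, unfolded o_def]
  \<comment> \<open>Passing to the limit in one scenario at a time uses only lower semicontinuity of
    the supremum.\<close>
  have "objective d x \<le> s"
    unfolding objective_le_iff[OF adm]
  proof
    fix w assume w: "w \<in> renewables d"
    have "(\<lambda>n. private_cost d (X (r n)) + scenario_cost d (PRt (X (r n))) w)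
        \<longlonglongrightarrow> private_cost d x + scenario_cost d (PRt x) w"
      using tendsto_add[OF converges_to_private_cost[OF adm _ conv] converges_to_scenario_cost[OF conv]]
        X(1) by simp
    moreover have "private_cost d (X n) + scenario_cost d (PRt (X n)) w \<le> S n" for n
      using X(2) w unfolding objective_le_iff[OF adm] by blast
    ultimately show "private_cost d x + scenario_cost d (PRt x) w \<le> s"
      using LIMSEQ_le[OF _ lims'(4)] by blast
  qed
  moreover have "reserve_residual d x t \<le> a $ coord d 1 t" if "t \<in> {1..nT d}" for t
    using LIMSEQ_le[OF res(1)[OF that] tendsto_vec_nth[OF lims'(1)]] Xr(1)[OF that] by blast
  moreover have "balance_residual d x t = b $ coord d 1 t" if "t \<in> {1..nT d}" for t
    using LIMSEQ_unique[OF res(2)[OF that]] tendsto_vec_nth[OF lims'(2)] Xr(2)[OF that] by simp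
  moreover have "exchange_residual d x t = c $ coord d 1 t" if "t \<in> {1..nT d}" for t
    using LIMSEQ_unique[OF res(3)[OF that]] tendsto_vec_nth[OF lims'(3)] Xr(3)[OF that] by simp
  ultimately show "p \<in> perturbation_epigraph d"
    unfolding pe perturbation_epigraph_iff using x by blast
qed

section \<open>Attainment of the primal minimum and weak duality\<close>

text \<open>Decisions with values below \<open>- real n\<close> would have a convergent subsequence,
  since the exchange residual vanishes on feasible points. Along it the cost in one fixed scenario,
  a lower bound for the objective, stays bounded, which contradicts \<open>n \<le> r n\<close> for
  large \<open>n\<close>.\<close>

lemma bdd_below_objective:
  assumes adm: "admissible_data d"
  shows "bdd_below (objective d ` feasible d)"
proof (rule ccontr)
  assume "\<not> ?thesis"
  then have "\<exists>x\<in>feasible d. objective d x < - real n" for n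
    unfolding bdd_below_def by (metis imageE not_le)
  then obtain X where X: "\<And>n. X n \<in> feasible d" "\<And>n. objective d (X n) < - real n"
    by metis
  have loc: "X n \<in> local_constraints d" for n
    using X(1) unfolding feasible_iff by blast
  have "(\<lambda>n. exchange_residual d (X n) t) \<longlonglongrightarrow> 0" if "t \<in> {1..nT d}" for t
    using X(1) that unfolding feasible_iff by simp
  from local_convergent_subseq[OF adm loc this]
  obtain r x where r: "strict_mono r" and conv: "converges_to d (X \<circ> r) x" by blast
  obtain w where w: "w \<in> renewables d"
    using adm unfolding admissible_data_def by blast
  have "(\<lambda>n. private_cost d (X (r n)) + scenario_cost d (PRt (X (r n))) w)
      \<longlonglongrightarrow> private_cost d x + scenario_cost d (PRt x) w"
    using tendsto_add[OF converges_to_private_cost[OF adm _ conv] converges_to_scenario_cost[OF conv]]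
      loc by simp
  then have "bounded (range (\<lambda>n. private_cost d (X (r n)) + scenario_cost d (PRt (X (r n))) w))"
    by (rule convergent_imp_bounded)
  then obtain K where K: "\<And>n. \<bar>private_cost d (X (r n)) + scenario_cost d (PRt (X (r n))) w\<bar> \<le> K"
    unfolding bounded_iff by auto
  have low: "private_cost d (X n) + scenario_cost d (PRt (X n)) w \<le> objective d (X n)" for n
    using objective_le_iff[OF adm, of "X n" "objective d (X n)"] w by blast
  obtain n where "K < real n" using reals_Archimedean2 by blast
  moreover have "n \<le> r n" using r by (rule seq_suble)
  ultimately show False
    using K[of n] low[of "r n"] X(2)[of "r n"] by linarith
qed

text \<open>The levels reached by feasible decisions form the fibre over zero of a closed set. This
  fibre is closed, nonempty and bounded below, so it contains its infimum, and a decision reaching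
  that level is a minimizer.\<close>

lemma primal_attained:
  assumes "admissible_data d" "feasible d \<noteq> {}"
  shows "\<exists>x\<in>feasible d. \<forall>y\<in>feasible d. objective d x \<le> objective d y"
proof -
  define V where "V = {s. (0, s) \<in> perturbation_epigraph d}"
  have V: "s \<in> V \<longleftrightarrow> (\<exists>x\<in>feasible d. objective d x \<le> s)" for s
    unfolding V_def perturbation_epigraph_zero by simp
  obtain K where K: "\<And>x. x \<in> feasible d \<Longrightarrow> K \<le> objective d x"
    using bdd_below_objective[OF assms(1)] unfolding bdd_below_def by blast
  have "closed ((\<lambda>s. (0, s)) -` perturbation_epigraph d)"
    by (intro closed_vimage closed_perturbation_epigraph assms(1) continuous_intros)
  then have "closed V" unfolding V_def vimage_def .
  moreover have "V \<noteq> {}" using assms(2) V by blast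
  moreover have bdd: "bdd_below V"
    by (rule bdd_belowI[of _ K]) (use V K order_trans in blast)
  ultimately have "Inf V \<in> V" by (intro closed_contains_Inf)
  then obtain x where x: "x \<in> feasible d" "objective d x \<le> Inf V" using V by blast
  moreover have "Inf V \<le> objective d y" if "y \<in> feasible d" for y
    using bdd by (rule cInf_lower[rotated]) (use V that in blast)
  ultimately show ?thesis by (meson order_trans)
qed

text \<open>At a feasible point the equality residuals vanish and the reserve residual is
  nonpositive, so the penalty terms can only lower the objective.\<close>

lemma weak_duality:
  assumes "(mu, lam, nu) \<in> multipliers d" "x \<in> feasible d"
  shows "dual_function d mu lam nu \<le> ereal (objective d x)"
proof -
  have "(\<Sum>t=1..nT d. mu t * reserve_residual d x t
     - lam t * balance_residual d x t - nu t * exchange_residual d x t) \<le> 0"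
    by (rule sum_nonpos)
      (use assms in \<open>auto simp: feasible_iff multipliers_def mult_nonneg_nonpos\<close>)
  then have "Lagrangian d x mu lam nu \<le> objective d x"
    unfolding Lagrangian_residuals by simp
  moreover have "dual_function d mu lam nu \<le> ereal (Lagrangian d x mu lam nu)"
    unfolding dual_function_def by (rule INF_lower) (use assms(2) in \<open>simp add: feasible_iff\<close>)
  ultimately show ?thesis by (meson ereal_less_eq(3) order_trans)
qed

section \<open>From the separating hyperplane to multipliers\<close>

text \<open>Turns a family indexed by slots, such as the residuals of a decision, into a
  perturbation. Nothing is placed outside the slot coordinates, so the inner product with a normal
  is a sum over slots.\<close>

definition slot_vector :: "('k::finite) microgrid \<Rightarrow> (nat \<Rightarrow> real) \<Rightarrow> real ^ 'k" where
  "slot_vector d f = (\<Sum>t=1..nT d. f t *\<^sub>R axis (coord d 1 t) 1)"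

lemma inner_slot_vector: "a \<bullet> slot_vector d f = (\<Sum>t=1..nT d. a $ coord d 1 t * f t)"
  unfolding slot_vector_def by (simp add: inner_sum_right inner_axis mult.commute)

text \<open>Distinct slots occupy distinct coordinates: \<open>coord d\<close> is injective on index
  pairs, and \<open>(1, t)\<close> is such a pair because there is at least one facility.\<close>

lemma slot_vector_nth:
  assumes "admissible_data d" "t \<in> {1..nT d}"
  shows "slot_vector d f $ coord d 1 t = f t"
proof -
  have inj: "inj_on (\<lambda>(i, t). coord d i t) ({1..nI d} \<times> {1..nT d})"
    using assms(1) unfolding admissible_data_def bij_betw_def by blast
  have "coord d 1 t = coord d 1 t' \<longleftrightarrow> t = t'" if "t' \<in> {1..nT d}" for t'
    using inj_onD[OF inj, of "(1, t)" "(1, t')"] that assms(2) admissible_nI[OF assms(1)] by auto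
  then have "slot_vector d f $ coord d 1 t = (\<Sum>t'=1..nT d. if t = t' then f t' else 0)"
    unfolding slot_vector_def sum_component by (intro sum.cong) (auto simp: axis_def)
  with assms(2) show ?thesis by simp
qed

text \<open>The slot entries of a separating normal serve as multipliers. Evaluating the separation
  inequality at the residuals of an arbitrary local decision bounds its Lagrangian below by
  \<open>q\<close>.\<close>

lemma approximate_multipliers:
  assumes adm: "admissible_data d" and price: "\<forall>t\<in>{1..nT d}. beta d t \<le> alpha d t"
    and x: "x \<in> feasible d" and below: "\<And>y. y \<in> feasible d \<Longrightarrow> q < objective d y"
  shows "\<exists>(mu, lam, nu)\<in>multipliers d. ereal q \<le> dual_function d mu lam nu"
proof -
  have "(0, objective d x) \<in> perturbation_epigraph d" "(0, q) \<notin> perturbation_epigraph d"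
    unfolding perturbation_epigraph_zero using x below by (blast, fastforce)
  from supporting_functional_below_graph[OF convex_perturbation_epigraph[OF adm price]
      closed_perturbation_epigraph[OF adm] this below[OF x]]
  obtain h where h: "\<And>z s. (z, s) \<in> perturbation_epigraph d \<Longrightarrow> q \<le> h \<bullet> z + s" by blast
  obtain a b c where habc: "h = (a, b, c)" by (metis prod.exhaust)
  \<comment> \<open>The Lagrangian adds the reserve term but subtracts the two equality terms, hence
    the signs.\<close>
  define mu where "mu t = a $ coord d 1 t" for t
  define lam where "lam t = - b $ coord d 1 t" for t
  define nu where "nu t = - c $ coord d 1 t" for t
  \<comment> \<open>The reserve perturbation \<open>f\<close> may exceed the residual. Taking it
    equal gives the bound on the Lagrangian; taking it large gives the sign of
    \<open>mu\<close>.\<close>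
  have bound: "q \<le> (\<Sum>t=1..nT d. mu t * f t) - (\<Sum>t=1..nT d. lam t * balance_residual d y t)
      - (\<Sum>t=1..nT d. nu t * exchange_residual d y t) + objective d y"
    if y: "y \<in> local_constraints d" and f: "\<And>t. t \<in> {1..nT d} \<Longrightarrow> reserve_residual d y t \<le> f t"
    for y f
  proof -
    have "((slot_vector d f, slot_vector d (balance_residual d y),
        slot_vector d (exchange_residual d y)), objective d y) \<in> perturbation_epigraph d"
      unfolding perturbation_epigraph_iff
      by (intro bexI[OF _ y] conjI ballI) (simp_all only: slot_vector_nth[OF adm] f order_refl)
    from h[OF this] show ?thesis
      unfolding habc mu_def lam_def nu_def by (simp add: inner_slot_vector sum_negf)
  qed
  text \<open>A negative entry of \<open>mu\<close> would let the slack in the reserve constraint drive the bound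
    to minus infinity.\<close>
  have "0 \<le> mu t" if t: "t \<in> {1..nT d}" for t
  proof (rule ccontr)
    assume neg: "\<not> 0 \<le> mu t"
    have xl: "x \<in> local_constraints d" using x unfolding feasible_iff by blast
    define K where "K = (\<Sum>t=1..nT d. mu t * reserve_residual d x t)
      - (\<Sum>t=1..nT d. lam t * balance_residual d x t)
      - (\<Sum>t=1..nT d. nu t * exchange_residual d x t) + objective d x"
    have "q \<le> K + mu t * s" if "0 \<le> s" for s
    proof -
      have "(\<Sum>t'=1..nT d. mu t' * (reserve_residual d x t' + (if t' = t then s else 0)))
          = (\<Sum>t'=1..nT d. mu t' * reserve_residual d x t') + mu t * s"
        unfolding distrib_left sum.distrib mult_delta_right using t by simp
      moreover have "reserve_residual d x t' \<le> reserve_residual d x t' + (if t' = t then s else 0)" for t'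
        using that by simp
      note bound[OF xl this]
      ultimately show ?thesis unfolding K_def by simp
    qed
    \<comment> \<open>With this slack the right-hand side becomes
      \<open>K - \<bar>K - q\<bar> - 1\<close>, which is at most \<open>q - 1\<close>.\<close>
    moreover have "0 \<le> (\<bar>K - q\<bar> + 1) / - mu t"
      using neg by (intro divide_nonneg_pos) auto
    ultimately have "q \<le> K + mu t * ((\<bar>K - q\<bar> + 1) / - mu t)" .
    also have "\<dots> = K - (\<bar>K - q\<bar> + 1)"
      using neg by simp
    finally show False by simp
  qed
  then have "(mu, lam, nu) \<in> multipliers d" unfolding multipliers_def by simp
  moreover have "ereal q \<le> dual_function d mu lam nu"
    unfolding dual_function_def
  proof (rule INF_greatest)
    fix y assume "y \<in> local_constraints d"
    from bound[OF this order_refl] show "ereal q \<le> ereal (Lagrangian d y mu lam nu)"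
      unfolding Lagrangian_residuals by (simp add: sum_subtractf)
  qed
  ultimately show ?thesis by blast
qed

theorem proposition2:
  fixes d :: "('k::finite) microgrid"
  assumes "admissible_data d"
    and "feasible d \<noteq> {}"
    and "\<forall>t\<in>{1..nT d}. beta d t \<le> alpha d t"
  shows "\<exists>x\<in>feasible d. (\<forall>y\<in>feasible d. objective d x \<le> objective d y) \<and>
    ereal (objective d x) = (SUP (mu, lam, nu)\<in>multipliers d. dual_function d mu lam nu)"
proof -
  obtain x where x: "x \<in> feasible d" and min: "\<And>y. y \<in> feasible d \<Longrightarrow> objective d x \<le> objective d y"
    using primal_attained[OF assms(1,2)] by blast
  have "(SUP (mu, lam, nu)\<in>multipliers d. dual_function d mu lam nu) \<le> ereal (objective d x)"
    by (rule SUP_least) (use weak_duality[OF _ x] in auto)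
  \<comment> \<open>Separation requires a level strictly below the optimum, so the bound is proved
    at \<open>objective d x - e\<close> for every positive \<open>e\<close>.\<close>
  moreover have "ereal (objective d x) \<le> (SUP (mu, lam, nu)\<in>multipliers d. dual_function d mu lam nu)"
  proof (rule ereal_le_epsilon2)
    fix e :: real assume "0 < e"
    then have "objective d x - e < objective d y" if "y \<in> feasible d" for y
      using min[OF that] by simp
    from approximate_multipliers[OF assms(1,3) x this]
    obtain mu lam nu where "(mu, lam, nu) \<in> multipliers d"
      "ereal (objective d x - e) \<le> dual_function d mu lam nu" by blast
    then have "ereal (objective d x - e) \<le> (SUP (mu, lam, nu)\<in>multipliers d. dual_function d mu lam nu)"
      by (intro SUP_upper2[of "(mu, lam, nu)"]) auto
    from add_right_mono[OF this, of "ereal e"]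
    show "ereal (objective d x) \<le> (SUP (mu, lam, nu)\<in>multipliers d. dual_function d mu lam nu) + ereal e"
      by simp
  qed
  ultimately show ?thesis using x min by (intro bexI[of _ x]) auto
qed

end
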